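(* Consider a network Cournot game with a system operator (NCGSO) on a market network $(A,B,c^-,c^+,H)$, with production cost functions $\Psi_i:\mathbb{R}_+^m\to\mathbb{R}_+$ ($i\in\mathcal N$) that are continuous, strictly increasing, convex, and satisfy $\Psi_i(0)=0$; affine inverse demand functions $\Phi_j:\mathbb{R}\to\mathbb{R}$ with $\Phi_j'=-\beta_j<0$ for every market $j\in\mathcal M$; and the Walrasian welfare function $$\omega(x,z)=\sum_{j\in\mathcal M}\int_0^{z_j}\Phi_j(s)\,\mathrm{d}s-\sum_{i\in\mathcal N}\Psi_i(x_i).$$ Then the NCGSO is an exact potential game with potential function $$P(x,y)=\omega(x,\operatorname{diag}(A'x)+By)-\sum_{i\in\mathcal N}\sum_{j\in\mathcal M}\frac{A_{ij}\beta_j}{2}x_{ij}^2,$$ and the set of its Nash equilibria coincides with $$\arg\max_{x\in\mathcal X,\;y\in\mathcal Y}P(x,y).$$ Moreover, for every two Nash equilibria $(x^*,y^* )$ and $(\tilde x^*,\tilde y^* )$, one has $x^*=\tilde x^*$ and $By^*=B\tilde y^*$.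
   Context: Market network. $\mathcal N=\{1,\dots,n\}$ is a nonempty finite set of producers, $\mathcal M=\{1,\dots,m\}$ a finite set of markets, $\mathcal L=\{1,\dots,l\}$ a finite set of links. Each link $k$ has a tail $\sigma_k\in\mathcal M$ and a head $\tau_k\in\mathcal M\setminus\{\sigma_k\}$ (parallel links are allowed). A market network is a tuple $(A,B,c^-,c^+,H)$ where: $A\in\{0,1\}^{n\times m}$ is the producer-market adjacency matrix ($A_{ij}=1$ iff producer $i$ can sell on market $j$; every producer can sell on at least one market); $B\in\{0,\pm1\}^{m\times l}$ is the market-link incidence matrix, $B_{jk}=1$ if $\tau_k=j$, $B_{jk}=-1$ if $\sigma_k=j$, $B_{jk}=0$ otherwise; $c^-,c^+\in\mathbb{R}_+^l$ are capacity vectors; $H\in\mathbb{R}^{l\times l}$ satisfies $BH=B$. Standing assumption: the market network is weakly connected, i.e. any two distinct markets are joined by a path of links ignoring orientation (equivalently $\mathrm{rank}(B)=m-1$). Game. The NCGSO has $n+1$ players: the system operator (player $0$) and the producers $1,\dots,n$. Producer $i$ has action set $\mathcal A_i=\{v\in\mathbb{R}_+^m: A_{ij}=0\Rightarrow v_j=0\}$, with actions $x_i=(x_{ij})_{j\in\mathcal M}$; $\mathcal X=\prod_{i\in\mathcal N}\mathcal A_i\subseteq\mathbb{R}_+^{n\times m}$. The system operator has action set $\mathcal Y=\{y\in\mathbb{R}^l: -c^-\le Hy\le c^+\}$ (entrywise). Let $\operatorname{diag}(A'x)\in\mathbb{R}^m$ be the vector with entries $\sum_{i\in\mathcal N}A_{ij}x_{ij}$.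 The utilities are $u_0(y,x)=\omega(x,\operatorname{diag}(A'x)+By)$ and, for $i\in\mathcal N$, $$u_i(x,y)=u_i(x_i,x_{-i},y)=\sum_{j\in\mathcal M}A_{ij}x_{ij}\,\Phi_j\Big(\sum_{h\in\mathcal N}A_{hj}x_{hj}+\sum_{k\in\mathcal L}B_{jk}y_k\Big)-\Psi_i(x_i),$$ where $x_{-i}$ denotes the actions of all producers other than $i$ (the same formulas define the utilities for all $x\in\mathbb{R}_+^{n\times m}$). A (pure-strategy) Nash equilibrium is $(x^*,y^* )\in\mathcal X\times\mathcal Y$ such that $y^*\in\arg\max_{y\in\mathcal Y}u_0(y,x^* )$ and, for every $i\in\mathcal N$, $x_i^*\in\arg\max_{x_i\in\mathcal A_i}u_i(x_i,x_{-i}^*,y^* )$. The NCGSO is an exact potential game with potential function $P(x,y)$ if: for every $i\in\mathcal N$, every $x,\tilde x\in\mathbb{R}_+^{n\times m}$ with $\tilde x_{-i}=x_{-i}$ and every $y\in\mathcal Y$, $P(\tilde x,y)-P(x,y)=u_i(\tilde x,y)-u_i(x,y)$; and for every $x\in\mathbb{R}_+^{n\times m}$ and every $y,\tilde y\in\mathcal Y$, $P(x,\tilde y)-P(x,y)=u_0(\tilde y,x)-u_0(y,x)$. "Strictly increasing" for $\Psi_i$ means $\Psi_i(v)<\Psi_i(w)$ whenever $v\le w$ entrywise and $v\ne w$. *)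

theory Defs
  imports "HOL-Analysis.Analysis" "Graph_Theory.Digraph_Component"
begin

text \<open>
  Producers and markets are the elements of the finite types \<open>'n\<close> and \<open>'m\<close>. Links are the arcs of a
  multidigraph on all of \<open>'m\<close>: they form a finite subset of \<open>'l\<close> rather than a whole type, because
  a network with a single market has no links and HOL types are nonempty. Vectors and matrices
  indexed by links are functions on \<open>'l\<close>, of which only the values on arcs are ever used.
\<close>

record ('n, 'm, 'l) network =
  adjacency :: "real ^ 'm ^ 'n"
  link_graph :: "('m, 'l) pre_digraph"
  cap_minus :: "'l \<Rightarrow> real"
  cap_plus :: "'l \<Rightarrow> real"
  flow_matrix :: "'l \<Rightarrow> 'l \<Rightarrow> real"

abbreviation links :: "('n::finite, 'm::finite, 'l) network \<Rightarrow> 'l set" where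
  "links N \<equiv> arcs (link_graph N)"

definition incidence :: "('n::finite, 'm::finite, 'l) network \<Rightarrow> 'm \<Rightarrow> 'l \<Rightarrow> real" where
  "incidence N j k =
    (if head (link_graph N) k = j then 1 else if tail (link_graph N) k = j then -1 else 0)"

text \<open>
  The constant \<open>Digraph_Component.connected\<close> is connectedness of the symmetric closure, i.e. weak
  connectedness; it is qualified here because of the topological constant of the same name.
\<close>

definition market_network :: "('n::finite, 'm::finite, 'l) network \<Rightarrow> bool" where
  "market_network N \<longleftrightarrow>
    (\<forall>i j. adjacency N $ i $ j \<in> {0, 1}) \<and>
    (\<forall>i. \<exists>j. adjacency N $ i $ j = 1) \<and>
    verts (link_graph N) = UNIV \<and>
    fin_digraph (link_graph N) \<and>
    loopfree_digraph (link_graph N) \<and>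
    Digraph_Component.connected (link_graph N) \<and>
    (\<forall>k\<in>links N. 0 \<le> cap_minus N k) \<and>
    (\<forall>k\<in>links N. 0 \<le> cap_plus N k) \<and>
    (\<forall>j. \<forall>k\<in>links N.
      (\<Sum>h\<in>links N. incidence N j h * flow_matrix N h k) = incidence N j k)"

text \<open>
  The vectors \<open>diag(A'x)\<close> and \<open>By\<close>.
\<close>

definition total_supply :: "('n::finite, 'm::finite, 'l) network \<Rightarrow> real ^ 'm ^ 'n \<Rightarrow> real ^ 'm" where
  "total_supply N x = (\<chi> j. \<Sum>i\<in>UNIV. adjacency N $ i $ j * x $ i $ j)"

definition net_inflow :: "('n::finite, 'm::finite, 'l) network \<Rightarrow> ('l \<Rightarrow> real) \<Rightarrow> real ^ 'm" where
  "net_inflow N y = (\<chi> j. \<Sum>k\<in>links N. incidence N j k * y k)"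

definition producer_actions :: "('n::finite, 'm::finite, 'l) network \<Rightarrow> 'n \<Rightarrow> (real ^ 'm) set" where
  "producer_actions N i = {v. (\<forall>j. 0 \<le> v $ j) \<and> (\<forall>j. adjacency N $ i $ j = 0 \<longrightarrow> v $ j = 0)}"

definition production_profiles :: "('n::finite, 'm::finite, 'l) network \<Rightarrow> (real ^ 'm ^ 'n) set" where
  "production_profiles N = {x. \<forall>i. x $ i \<in> producer_actions N i}"

text \<open>
  Operator actions are extensional functions, so that each element of the original action space,
  vectors indexed by links, is represented exactly once.
\<close>

definition operator_actions :: "('n::finite, 'm::finite, 'l) network \<Rightarrow> ('l \<Rightarrow> real) set" where
  "operator_actions N =
    {y \<in> links N \<rightarrow>\<^sub>E UNIV. \<forall>k\<in>links N.
      - cap_minus N k \<le> (\<Sum>h\<in>links N. flow_matrix N k h * y h) \<and>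
      (\<Sum>h\<in>links N. flow_matrix N k h * y h) \<le> cap_plus N k}"

definition operator_utility ::
  "('n::finite, 'm::finite, 'l) network \<Rightarrow> (real ^ 'm ^ 'n \<Rightarrow> real ^ 'm \<Rightarrow> real) \<Rightarrow>
    ('l \<Rightarrow> real) \<Rightarrow> real ^ 'm ^ 'n \<Rightarrow> real" where
  "operator_utility N \<omega> y x = \<omega> x (total_supply N x + net_inflow N y)"

definition producer_utility ::
  "('n::finite, 'm::finite, 'l) network \<Rightarrow> ('m \<Rightarrow> real \<Rightarrow> real) \<Rightarrow> ('n \<Rightarrow> real ^ 'm \<Rightarrow> real) \<Rightarrow>
    'n \<Rightarrow> real ^ 'm ^ 'n \<Rightarrow> ('l \<Rightarrow> real) \<Rightarrow> real" where
  "producer_utility N \<Phi> \<Psi> i x y =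
    (\<Sum>j\<in>UNIV. adjacency N $ i $ j * x $ i $ j * \<Phi> j ((total_supply N x + net_inflow N y) $ j))
      - \<Psi> i (x $ i)"

definition replace_action :: "real ^ 'm ^ 'n \<Rightarrow> 'n \<Rightarrow> real ^ 'm \<Rightarrow> real ^ 'm ^ 'n::finite" where
  "replace_action x i v = (\<chi> h. if h = i then v else x $ h)"

definition nash_equilibria ::
  "('n::finite, 'm::finite, 'l) network \<Rightarrow> ('m \<Rightarrow> real \<Rightarrow> real) \<Rightarrow> ('n \<Rightarrow> real ^ 'm \<Rightarrow> real) \<Rightarrow>
    (real ^ 'm ^ 'n \<Rightarrow> real ^ 'm \<Rightarrow> real) \<Rightarrow> ((real ^ 'm ^ 'n) \<times> ('l \<Rightarrow> real)) set" where
  "nash_equilibria N \<Phi> \<Psi> \<omega> =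
    {(x, y). x \<in> production_profiles N \<and> y \<in> operator_actions N \<and>
      is_arg_max (\<lambda>y'. operator_utility N \<omega> y' x) (\<lambda>y'. y' \<in> operator_actions N) y \<and>
      (\<forall>i. is_arg_max (\<lambda>v. producer_utility N \<Phi> \<Psi> i (replace_action x i v) y)
        (\<lambda>v. v \<in> producer_actions N i) (x $ i))}"

definition is_exact_potential ::
  "('n::finite, 'm::finite, 'l) network \<Rightarrow> ('m \<Rightarrow> real \<Rightarrow> real) \<Rightarrow> ('n \<Rightarrow> real ^ 'm \<Rightarrow> real) \<Rightarrow>
    (real ^ 'm ^ 'n \<Rightarrow> real ^ 'm \<Rightarrow> real) \<Rightarrow> (real ^ 'm ^ 'n \<Rightarrow> ('l \<Rightarrow> real) \<Rightarrow> real) \<Rightarrow> bool" where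
  "is_exact_potential N \<Phi> \<Psi> \<omega> P \<longleftrightarrow>
    (\<forall>i. \<forall>x\<in>{0..}. \<forall>x'\<in>{0..}. \<forall>y\<in>operator_actions N. (\<forall>h. h \<noteq> i \<longrightarrow> x' $ h = x $ h) \<longrightarrow>
      P x' y - P x y = producer_utility N \<Phi> \<Psi> i x' y - producer_utility N \<Phi> \<Psi> i x y) \<and>
    (\<forall>x\<in>{0..}. \<forall>y\<in>operator_actions N. \<forall>y'\<in>operator_actions N.
      P x y' - P x y = operator_utility N \<omega> y' x - operator_utility N \<omega> y x)"

text \<open>
  For nonnegative vectors we use the entrywise order of \<^typ>\<open>real ^ 'm\<close>: \<^term>\<open>{0::real ^ 'm..}\<close> is the
  nonnegative orthant and \<open>v < w\<close> means that \<open>v \<le> w\<close> entrywise and \<open>v \<noteq> w\<close>. Values of a cost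
  function outside the orthant are irrelevant.
\<close>

definition production_cost :: "(real ^ 'm::finite \<Rightarrow> real) \<Rightarrow> bool" where
  "production_cost \<psi> \<longleftrightarrow>
    (\<forall>v\<in>{0..}. 0 \<le> \<psi> v) \<and> continuous_on {0..} \<psi> \<and> strict_mono_on {0..} \<psi> \<and>
    convex_on {0..} \<psi> \<and> \<psi> 0 = 0"

text \<open>
  The interval integral is oriented, so it is the intended one also for negative \<open>z $ j\<close>.
\<close>

definition walrasian_welfare ::
  "('m \<Rightarrow> real \<Rightarrow> real) \<Rightarrow> ('n \<Rightarrow> real ^ 'm \<Rightarrow> real) \<Rightarrow>
    real ^ 'm::finite ^ 'n::finite \<Rightarrow> real ^ 'm \<Rightarrow> real" where
  "walrasian_welfare \<Phi> \<Psi> x z =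
    (\<Sum>j\<in>UNIV. LBINT s = ereal 0..ereal (z $ j). \<Phi> j s) - (\<Sum>i\<in>UNIV. \<Psi> i (x $ i))"

definition cournot_potential ::
  "('n::finite, 'm::finite, 'l) network \<Rightarrow> (real ^ 'm ^ 'n \<Rightarrow> real ^ 'm \<Rightarrow> real) \<Rightarrow> ('m \<Rightarrow> real) \<Rightarrow>
    real ^ 'm ^ 'n \<Rightarrow> ('l \<Rightarrow> real) \<Rightarrow> real" where
  "cournot_potential N \<omega> \<beta> x y =
    \<omega> x (total_supply N x + net_inflow N y)
      - (\<Sum>i\<in>UNIV. \<Sum>j\<in>UNIV. adjacency N $ i $ j * \<beta> j / 2 * (x $ i $ j)\<^sup>2)"

end

theory Submission
  imports Defs
begin

text \<open>
  The potential is a concave quadratic form in the supplies and net inflows minus the separable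
  convex costs. At a Nash equilibrium every unilateral deviation towards another profile has
  nonpositive slope; the slopes add up because the only nonsmooth part, the cost, is separable across
  producers. Hence the potential drops, on passing to any other profile, by at least the quadratic
  term of its expansion, which vanishes only if productions and net inflows both agree.
\<close>

section \<open>An elementary limit argument and the integral of an affine function\<close>

text \<open>Dividing by \<open>t\<close> leaves \<open>g - t * k \<le> 0\<close>, and
  \<open>t\<close> may be taken arbitrarily small. This turns optimality along a segment into a
  first-order condition.\<close>

lemma nonpos_slope_if_quadratic_nonpos:
  fixes g k :: real
  assumes "\<And>t. 0 < t \<Longrightarrow> t \<le> 1 \<Longrightarrow> t * g - t\<^sup>2 * k \<le> 0"
  shows "g \<le> 0"
proof (rule ccontr)
  assume "\<not> g \<le> 0"
  then have g: "0 < g" by simp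
  \<comment> \<open>Small enough that \<open>t * k\<close> stays below \<open>g\<close>. The
    positive number \<open>\<bar>k\<bar> + 1\<close> bounds \<open>k\<close> for either sign and may
    safely be divided by.\<close>
  define t where "t = min 1 (g / (2 * (\<bar>k\<bar> + 1)))"
  have t: "0 < t" "t \<le> 1" using g by (auto simp: t_def)
  have "t * (\<bar>k\<bar> + 1) \<le> g / (2 * (\<bar>k\<bar> + 1)) * (\<bar>k\<bar> + 1)"
    by (intro mult_right_mono) (auto simp: t_def)
  also have "\<dots> = g / 2" by (simp add: field_simps)
  finally have "t * (\<bar>k\<bar> + 1) < g" using g by simp
  moreover have "t * k \<le> t * (\<bar>k\<bar> + 1)" using t by (intro mult_left_mono) auto
  ultimately have "0 < t * (g - t * k)" using t by (intro mult_pos_pos) linarith+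
  then show False using assms[OF t] by (simp add: algebra_simps power2_eq_square)
qed

lemma interval_integral_affine:
  fixes a b z :: real
  shows "(LBINT s = ereal 0..ereal z. a + b * s) = a * z + b * z\<^sup>2 / 2"
proof -
  have "(LBINT s = ereal 0..ereal z. a + b * s)
      = (a * z + b * z\<^sup>2 / 2) - (a * 0 + b * 0\<^sup>2 / 2)"
    by (rule interval_integral_FTC_finite)
      (auto intro!: continuous_intros derivative_eq_intros
        simp flip: has_real_derivative_iff_has_vector_derivative)
  then show ?thesis by simp
qed

section \<open>Unilateral deviations and convexity of the action sets\<close>

lemma replace_action_nth [simp]:
  "replace_action x i v $ h = (if h = i then v else x $ h)"
  by (simp add: replace_action_def)

lemma replace_action_in_production_profiles:
  assumes "x \<in> production_profiles N" "v \<in> producer_actions N i"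
  shows "replace_action x i v \<in> production_profiles N"
  using assms by (simp add: production_profiles_def)

lemma convex_producer_actions: "convex (producer_actions N i)"
  unfolding convex_def producer_actions_def by auto

text \<open>\<open>restrict\<close> makes the mixture extensional by construction, as membership in
  \<open>operator_actions\<close> demands.\<close>

definition operator_mix ::
  "('n::finite, 'm::finite, 'l) network \<Rightarrow> real \<Rightarrow> ('l \<Rightarrow> real) \<Rightarrow> ('l \<Rightarrow> real) \<Rightarrow> 'l \<Rightarrow> real" where
  "operator_mix N t y y' = restrict (\<lambda>k. (1 - t) * y k + t * y' k) (links N)"

text \<open>The flow through a link is linear in the action, and the capacities confine it to an
  interval, which is convex.\<close>

lemma operator_mix_in_operator_actions:
  assumes "y \<in> operator_actions N" "y' \<in> operator_actions N" "0 \<le> t" "t \<le> 1"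
  shows "operator_mix N t y y' \<in> operator_actions N"
proof -
  define H where "H k w = (\<Sum>h\<in>links N. flow_matrix N k h * w h)" for k w
  have mix: "H k (operator_mix N t y y') = (1 - t) * H k y + t * H k y'" for k
    by (simp add: H_def operator_mix_def sum_distrib_left sum.distrib[symmetric] algebra_simps
        cong: sum.cong)
  have "- cap_minus N k \<le> H k (operator_mix N t y y') \<and>
      H k (operator_mix N t y y') \<le> cap_plus N k" if "k \<in> links N" for k
  proof -
    have "H k w \<in> {- cap_minus N k..cap_plus N k}" if "w \<in> operator_actions N" for w
      using that \<open>k \<in> links N\<close> by (simp add: operator_actions_def H_def)
    then have "(1 - t) *\<^sub>R H k y + t *\<^sub>R H k y' \<in> {- cap_minus N k..cap_plus N k}"
      using assms by (intro convexD) auto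
    then show ?thesis by (simp add: mix)
  qed
  then show ?thesis
    by (simp add: operator_actions_def H_def operator_mix_def)
qed

lemma net_inflow_operator_mix:
  "net_inflow N (operator_mix N t y y') = net_inflow N y + t *\<^sub>R (net_inflow N y' - net_inflow N y)"
  by (simp add: vec_eq_iff net_inflow_def operator_mix_def sum_distrib_left sum.distrib[symmetric]
      sum_subtractf[symmetric] algebra_simps cong: sum.cong)

section \<open>Quadratic expansions of welfare, potential and profit\<close>

locale affine_ncgso =
  fixes N :: "('n::finite, 'm::finite, 'l) network"
    and \<Psi> :: "'n \<Rightarrow> real ^ 'm \<Rightarrow> real"
    and \<Phi> :: "'m \<Rightarrow> real \<Rightarrow> real"
    and \<beta> :: "'m \<Rightarrow> real"
  assumes adjacency_01: "\<And>i j. adjacency N $ i $ j \<in> {0, 1}"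
    and cost_convex: "\<And>i. convex_on {0..} (\<Psi> i)"
    and demand: "\<And>j s. \<Phi> j s = \<Phi> j 0 - \<beta> j * s"
    and slope_pos: "\<And>j. 0 < \<beta> j"
begin

abbreviation A :: "'n \<Rightarrow> 'm \<Rightarrow> real" where
  "A i j \<equiv> adjacency N $ i $ j"

abbreviation quantity :: "real ^ 'm ^ 'n \<Rightarrow> ('l \<Rightarrow> real) \<Rightarrow> real ^ 'm" where
  "quantity x y \<equiv> total_supply N x + net_inflow N y"

abbreviation \<omega> :: "real ^ 'm ^ 'n \<Rightarrow> real ^ 'm \<Rightarrow> real" where
  "\<omega> \<equiv> walrasian_welfare \<Phi> \<Psi>"

abbreviation P :: "real ^ 'm ^ 'n \<Rightarrow> ('l \<Rightarrow> real) \<Rightarrow> real" where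
  "P \<equiv> cournot_potential N \<omega> \<beta>"

lemma adjacency_nonneg: "0 \<le> A i j"
  using adjacency_01[of i j] by auto

lemma walrasian_welfare_eq:
  "\<omega> x z = (\<Sum>j\<in>UNIV. \<Phi> j 0 * z $ j - \<beta> j * (z $ j)\<^sup>2 / 2) - (\<Sum>i\<in>UNIV. \<Psi> i (x $ i))"
proof -
  have "(LBINT s = ereal 0..ereal (z $ j). \<Phi> j s) = \<Phi> j 0 * z $ j - \<beta> j * (z $ j)\<^sup>2 / 2" for j
    using interval_integral_affine[of "z $ j" "\<Phi> j 0" "- \<beta> j"] by (subst demand) simp
  then show ?thesis by (simp add: walrasian_welfare_def)
qed

text \<open>The integrated demand is quadratic, so its second-order Taylor expansion is exact; the
  first-order coefficient is the price at the old quantity.\<close>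

lemma walrasian_welfare_increment:
  "\<omega> x' (z + e) - \<omega> x z = (\<Sum>j\<in>UNIV. \<Phi> j (z $ j) * e $ j - \<beta> j * (e $ j)\<^sup>2 / 2)
     - (\<Sum>i\<in>UNIV. \<Psi> i (x' $ i) - \<Psi> i (x $ i))"
proof -
  have "\<Phi> j 0 * (z $ j + e $ j) - \<beta> j * (z $ j + e $ j)\<^sup>2 / 2
      - (\<Phi> j 0 * z $ j - \<beta> j * (z $ j)\<^sup>2 / 2) = \<Phi> j (z $ j) * e $ j - \<beta> j * (e $ j)\<^sup>2 / 2" for j
    \<comment> \<open>The instance at \<open>z $ j\<close> leaves the intercept
      \<open>\<Phi> j 0\<close> alone, which an uninstantiated \<open>demand\<close> would match as
      well.\<close>
    by (subst demand[of _ "z $ j"]) (simp add: field_simps power2_eq_square)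
  then have "(\<Sum>j\<in>UNIV. \<Phi> j 0 * (z + e) $ j - \<beta> j * ((z + e) $ j)\<^sup>2 / 2)
      - (\<Sum>j\<in>UNIV. \<Phi> j 0 * z $ j - \<beta> j * (z $ j)\<^sup>2 / 2)
    = (\<Sum>j\<in>UNIV. \<Phi> j (z $ j) * e $ j - \<beta> j * (e $ j)\<^sup>2 / 2)"
    unfolding sum_subtractf[symmetric] by simp
  then show ?thesis
    unfolding walrasian_welfare_eq sum_subtractf[of "\<lambda>i. \<Psi> i (x' $ i)"] by linarith
qed

text \<open>Both arguments may change at once, so joint deviations of all players are covered
  too.\<close>

lemma cournot_potential_increment:
  fixes x x' y y'
  defines "z \<equiv> quantity x y" and "e \<equiv> quantity x' y' - quantity x y"
  shows "P x' y' - P x y = (\<Sum>j\<in>UNIV. \<Phi> j (z $ j) * e $ j - \<beta> j * (e $ j)\<^sup>2 / 2)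
    - (\<Sum>i\<in>UNIV. \<Psi> i (x' $ i) - \<Psi> i (x $ i))
    - (\<Sum>i\<in>UNIV. \<Sum>j\<in>UNIV. A i j * \<beta> j / 2 * ((x' $ i $ j)\<^sup>2 - (x $ i $ j)\<^sup>2))"
  using walrasian_welfare_increment[of x' z e x]
  by (simp add: cournot_potential_def z_def e_def sum_subtractf right_diff_distrib)

lemma quantity_deviation:
  assumes "\<forall>h. h \<noteq> i \<longrightarrow> x' $ h = x $ h"
  shows "(quantity x' y - quantity x y) $ j = A i j * (x' $ i $ j - x $ i $ j)"
proof -
  have "(quantity x' y - quantity x y) $ j = (\<Sum>h\<in>UNIV. A h j * (x' $ h $ j - x $ h $ j))"
    by (simp add: total_supply_def sum_subtractf right_diff_distrib)
  also have "\<dots> = (\<Sum>h\<in>{i}. A h j * (x' $ h $ j - x $ h $ j))"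
    using assms by (intro sum.mono_neutral_right) auto
  finally show ?thesis by simp
qed

text \<open>The deviation lowers the price by \<open>\<beta> j * A i j * d $ j\<close> on everything
  now sold, so the increment pairs the old price with the new own quantity
  \<open>x' $ i $ j\<close>. The two adjacency factors merge because entries 0 and 1 equal their
  squares.\<close>

lemma producer_utility_increment:
  fixes x x' y
  assumes "\<forall>h. h \<noteq> i \<longrightarrow> x' $ h = x $ h"
  defines "d \<equiv> x' $ i - x $ i"
  shows "producer_utility N \<Phi> \<Psi> i x' y - producer_utility N \<Phi> \<Psi> i x y
    = (\<Sum>j\<in>UNIV. A i j * d $ j * (\<Phi> j (quantity x y $ j) - \<beta> j * x' $ i $ j))
      - (\<Psi> i (x' $ i) - \<Psi> i (x $ i))"
proof -
  have "A i j * x' $ i $ j * \<Phi> j (quantity x' y $ j) - A i j * x $ i $ j * \<Phi> j (quantity x y $ j)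
      = A i j * d $ j * (\<Phi> j (quantity x y $ j) - \<beta> j * x' $ i $ j)" for j
  proof -
    have q: "quantity x' y $ j = quantity x y $ j + A i j * d $ j"
      using quantity_deviation[of i x' x y j, OF assms(1)] by (simp add: d_def)
    have price: "\<Phi> j (quantity x' y $ j) = \<Phi> j (quantity x y $ j) - \<beta> j * (A i j * d $ j)"
      unfolding q by (subst (1 2) demand) (simp add: algebra_simps)
    show ?thesis
      unfolding price unfolding d_def using adjacency_01[of i j] by (elim insertE) (simp_all add: algebra_simps)
  qed
  then show ?thesis
    unfolding producer_utility_def by (simp add: sum_subtractf[symmetric])
qed

section \<open>The exact potential property and its maximizers\<close>

text \<open>On each market that the producer serves, welfare contributes half of \<open>d^2\<close>
  and the correction term half of \<open>x'^2 - x^2\<close>, both weighted by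
  \<open>- \<beta> j\<close>. Together they give \<open>d * x'\<close>, which is the price effect in
  the producer's utility.\<close>

lemma potential_producer_increment:
  assumes same: "\<forall>h. h \<noteq> i \<longrightarrow> x' $ h = x $ h"
  shows "P x' y - P x y = producer_utility N \<Phi> \<Psi> i x' y - producer_utility N \<Phi> \<Psi> i x y"
proof -
  define d where "d = x' $ i - x $ i"
  have cost: "(\<Sum>h\<in>UNIV. \<Psi> h (x' $ h) - \<Psi> h (x $ h)) = (\<Sum>h\<in>{i}. \<Psi> h (x' $ h) - \<Psi> h (x $ h))"
    using same by (intro sum.mono_neutral_right) auto
  have square: "(\<Sum>h\<in>UNIV. \<Sum>j\<in>UNIV. A h j * \<beta> j / 2 * ((x' $ h $ j)\<^sup>2 - (x $ h $ j)\<^sup>2))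
      = (\<Sum>h\<in>{i}. \<Sum>j\<in>UNIV. A h j * \<beta> j / 2 * ((x' $ h $ j)\<^sup>2 - (x $ h $ j)\<^sup>2))"
    using same by (intro sum.mono_neutral_right) auto
  have "\<Phi> j (quantity x y $ j) * (A i j * d $ j) - \<beta> j * (A i j * d $ j)\<^sup>2 / 2
      - A i j * \<beta> j / 2 * ((x' $ i $ j)\<^sup>2 - (x $ i $ j)\<^sup>2)
    = A i j * d $ j * (\<Phi> j (quantity x y $ j) - \<beta> j * x' $ i $ j)" for j
    using adjacency_01[of i j] by (auto simp: d_def field_simps power2_eq_square)
  then have "(\<Sum>j\<in>UNIV. \<Phi> j (quantity x y $ j) * (A i j * d $ j) - \<beta> j * (A i j * d $ j)\<^sup>2 / 2)
      - (\<Sum>j\<in>UNIV. A i j * \<beta> j / 2 * ((x' $ i $ j)\<^sup>2 - (x $ i $ j)\<^sup>2))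
    = (\<Sum>j\<in>UNIV. A i j * d $ j * (\<Phi> j (quantity x y $ j) - \<beta> j * x' $ i $ j))"
    unfolding sum_subtractf[symmetric] by simp
  then show ?thesis
    unfolding cournot_potential_increment producer_utility_increment[of i x' x y, OF same] cost square
      quantity_deviation[of i x' x y, OF same]
    by (simp add: d_def)
qed

text \<open>The correction term does not depend on the operator's action and cancels.\<close>

lemma potential_operator_increment:
  "P x y' - P x y = operator_utility N \<omega> y' x - operator_utility N \<omega> y x"
  by (simp add: cournot_potential_def operator_utility_def)

lemma exact_potential: "is_exact_potential N \<Phi> \<Psi> \<omega> P"
  unfolding is_exact_potential_def
  using potential_producer_increment potential_operator_increment by blast

text \<open>A unilateral deviation stays in the product of the action sets and changes the
  deviator's utility exactly as it changes the potential.\<close>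

lemma maximizer_is_nash:
  assumes x: "x \<in> production_profiles N" and y: "y \<in> operator_actions N"
    and max: "\<And>x' y'. x' \<in> production_profiles N \<Longrightarrow> y' \<in> operator_actions N \<Longrightarrow> P x' y' \<le> P x y"
  shows "(x, y) \<in> nash_equilibria N \<Phi> \<Psi> \<omega>"
proof -
  have "operator_utility N \<omega> y' x \<le> operator_utility N \<omega> y x" if "y' \<in> operator_actions N" for y'
    using max[OF x that] potential_operator_increment[of x y' y] by simp
  moreover have "producer_utility N \<Phi> \<Psi> i (replace_action x i v) y
      \<le> producer_utility N \<Phi> \<Psi> i (replace_action x i (x $ i)) y"
    if "v \<in> producer_actions N i" for i v
  proof -
    have "replace_action x i (x $ i) = x" by (simp add: vec_eq_iff)
    then show ?thesis
      using max[OF replace_action_in_production_profiles[OF x that] y]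
        potential_producer_increment[of i "replace_action x i v" x y] by simp
  qed
  moreover have "x $ i \<in> producer_actions N i" for i
    using x by (simp add: production_profiles_def)
  ultimately show ?thesis
    using x y by (auto simp: nash_equilibria_def is_arg_max_def not_less)
qed

section \<open>First-order conditions at an equilibrium\<close>

text \<open>Revenue is linearised at the equilibrium, with the marginal revenue as coefficient. The
  possibly nonsmooth cost enters through its full difference, since convexity bounds its change
  along the segment by \<open>t\<close> times that difference.\<close>

lemma nash_producer_slope:
  assumes nash: "(x, y) \<in> nash_equilibria N \<Phi> \<Psi> \<omega>" and v: "v \<in> producer_actions N i"
  shows "(\<Sum>j\<in>UNIV. A i j * (v - x $ i) $ j * (\<Phi> j (quantity x y $ j) - \<beta> j * x $ i $ j))
      - (\<Psi> i v - \<Psi> i (x $ i)) \<le> 0" (is "?L - ?C \<le> 0")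
proof (rule nonpos_slope_if_quadratic_nonpos)
  fix t :: real
  assume t: "0 < t" "t \<le> 1"
  define d where "d = v - x $ i"
  define w where "w = (1 - t) *\<^sub>R x $ i + t *\<^sub>R v"
  define x' where "x' = replace_action x i w"
  have xi: "x $ i \<in> producer_actions N i"
    using nash by (auto simp: nash_equilibria_def production_profiles_def)
  then have "w \<in> producer_actions N i"
    unfolding w_def using v t by (intro convexD[OF convex_producer_actions]) auto
  moreover have "replace_action x i (x $ i) = x" by (simp add: vec_eq_iff)
  ultimately have le: "producer_utility N \<Phi> \<Psi> i x' y - producer_utility N \<Phi> \<Psi> i x y \<le> 0"
    using nash unfolding nash_equilibria_def is_arg_max_def x'_def
    by (smt (verit) case_prodD mem_Collect_eq)
  have w_eq: "w = x $ i + t *\<^sub>R d"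
    by (simp add: w_def d_def algebra_simps)
  have "x $ i \<in> {0..}" "v \<in> {0..}"
    using xi v by (auto simp: producer_actions_def less_eq_vec_def)
  then have "\<Psi> i w \<le> (1 - t) * \<Psi> i (x $ i) + t * \<Psi> i v"
    unfolding w_def using t by (intro convex_onD[OF cost_convex]) auto
  then have cost: "\<Psi> i w - \<Psi> i (x $ i) \<le> t * ?C"
    by (simp add: algebra_simps)
  \<comment> \<open>The own quantity is evaluated at the deviation
    \<open>x $ i + t *\<^sub>R d\<close>; this produces the term of second order in
    \<open>t\<close>.\<close>
  have "(\<Sum>j\<in>UNIV. A i j * (x' $ i - x $ i) $ j * (\<Phi> j (quantity x y $ j) - \<beta> j * x' $ i $ j))
      = t * ?L - t\<^sup>2 * (\<Sum>j\<in>UNIV. A i j * \<beta> j * (d $ j)\<^sup>2)"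
    unfolding sum_distrib_left sum_subtractf[symmetric]
    by (intro sum.cong) (simp_all add: x'_def w_eq d_def algebra_simps power2_eq_square)
  then have "t * ?L - t\<^sup>2 * (\<Sum>j\<in>UNIV. A i j * \<beta> j * (d $ j)\<^sup>2) - (\<Psi> i w - \<Psi> i (x $ i)) \<le> 0"
    using le producer_utility_increment[of i x' x y] by (simp add: x'_def)
  then show "t * (?L - ?C) - t\<^sup>2 * (\<Sum>j\<in>UNIV. A i j * \<beta> j * (d $ j)\<^sup>2) \<le> 0"
    using cost by (simp add: right_diff_distrib)
qed

text \<open>Along a mixture of operator actions the supplies and costs are fixed and the net inflow
  moves linearly, so the welfare expansion supplies a quadratic in \<open>t\<close>.\<close>

lemma nash_operator_slope:
  assumes nash: "(x, y) \<in> nash_equilibria N \<Phi> \<Psi> \<omega>" and y': "y' \<in> operator_actions N"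
  shows "(\<Sum>j\<in>UNIV. \<Phi> j (quantity x y $ j) * (net_inflow N y' - net_inflow N y) $ j) \<le> 0"
    (is "?L \<le> 0")
proof (rule nonpos_slope_if_quadratic_nonpos)
  fix t :: real
  assume t: "0 < t" "t \<le> 1"
  define e where "e = net_inflow N y' - net_inflow N y"
  define w where "w = operator_mix N t y y'"
  have "w \<in> operator_actions N"
    unfolding w_def using nash y' t
    by (intro operator_mix_in_operator_actions) (auto simp: nash_equilibria_def)
  then have "operator_utility N \<omega> w x - operator_utility N \<omega> y x \<le> 0"
    using nash by (auto simp: nash_equilibria_def is_arg_max_def not_less)
  moreover have "quantity x w = quantity x y + t *\<^sub>R e"
    by (simp add: w_def e_def net_inflow_operator_mix)
  ultimately have "(\<Sum>j\<in>UNIV. \<Phi> j (quantity x y $ j) * (t *\<^sub>R e) $ j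
      - \<beta> j * ((t *\<^sub>R e) $ j)\<^sup>2 / 2) \<le> 0"
    using walrasian_welfare_increment[of x "quantity x y" "t *\<^sub>R e" x]
    by (simp add: operator_utility_def)
  also have "(\<Sum>j\<in>UNIV. \<Phi> j (quantity x y $ j) * (t *\<^sub>R e) $ j - \<beta> j * ((t *\<^sub>R e) $ j)\<^sup>2 / 2)
      = t * ?L - t\<^sup>2 * (\<Sum>j\<in>UNIV. \<beta> j * (e $ j)\<^sup>2 / 2)"
    unfolding sum_distrib_left sum_subtractf[symmetric]
    by (intro sum.cong) (simp_all add: e_def algebra_simps power2_eq_square)
  finally show "t * ?L - t\<^sup>2 * (\<Sum>j\<in>UNIV. \<beta> j * (e $ j)\<^sup>2 / 2) \<le> 0" .
qed

section \<open>Strict optimality and uniqueness of equilibria\<close>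

text \<open>The two sums of squares measure how far the profiles differ in quantities and in
  productions. Keeping them in the bound lets one estimate yield both maximality and
  uniqueness.\<close>

lemma nash_potential_gap:
  assumes nash: "(x, y) \<in> nash_equilibria N \<Phi> \<Psi> \<omega>"
    and x': "x' \<in> production_profiles N" and y': "y' \<in> operator_actions N"
  shows "P x' y' + (\<Sum>j\<in>UNIV. \<beta> j / 2 * ((quantity x' y' - quantity x y) $ j)\<^sup>2)
    + (\<Sum>i\<in>UNIV. \<Sum>j\<in>UNIV. A i j * \<beta> j / 2 * (x' $ i $ j - x $ i $ j)\<^sup>2) \<le> P x y"
proof -
  define z where "z = quantity x y"
  define e where "e = quantity x' y' - quantity x y"
  define f where "f = net_inflow N y' - net_inflow N y"
  define D where "D i j = x' $ i $ j - x $ i $ j" for i j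
  define L where "L i = (\<Sum>j\<in>UNIV. A i j * D i j * (\<Phi> j (z $ j) - \<beta> j * x $ i $ j))" for i
  have "L i - (\<Psi> i (x' $ i) - \<Psi> i (x $ i)) \<le> 0" for i
    using nash_producer_slope[OF nash, of "x' $ i" i] x'
    by (simp add: L_def D_def z_def production_profiles_def)
  then have "(\<Sum>i\<in>UNIV. L i - (\<Psi> i (x' $ i) - \<Psi> i (x $ i))) \<le> 0"
    by (intro sum_nonpos)
  then have producers: "(\<Sum>i\<in>UNIV. L i) - (\<Sum>i\<in>UNIV. \<Psi> i (x' $ i) - \<Psi> i (x $ i)) \<le> 0"
    by (simp add: sum_subtractf)
  have operator: "(\<Sum>j\<in>UNIV. \<Phi> j (z $ j) * f $ j) \<le> 0"
    using nash_operator_slope[OF nash y'] by (simp add: z_def f_def)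
  have e_eq: "e $ j = (\<Sum>i\<in>UNIV. A i j * D i j) + f $ j" for j
    by (simp add: e_def f_def D_def total_supply_def sum_subtractf right_diff_distrib)
  \<comment> \<open>Exchanging the sums regroups the first-order term from markets to producers, so
    that it can be compared with the individual slopes.\<close>
  have linear: "(\<Sum>j\<in>UNIV. \<Phi> j (z $ j) * e $ j)
      = (\<Sum>i\<in>UNIV. \<Sum>j\<in>UNIV. \<Phi> j (z $ j) * (A i j * D i j)) + (\<Sum>j\<in>UNIV. \<Phi> j (z $ j) * f $ j)"
    by (subst sum.swap) (simp add: e_eq distrib_left sum.distrib sum_distrib_left)
  have L_eq: "L i = (\<Sum>j\<in>UNIV. \<Phi> j (z $ j) * (A i j * D i j))
      - (\<Sum>j\<in>UNIV. A i j * D i j * (\<beta> j * x $ i $ j))" for i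
    unfolding L_def sum_subtractf[symmetric] by (simp add: algebra_simps)
  \<comment> \<open>Expanding around \<open>x\<close>: the part linear in \<open>D\<close> belongs
    to the marginal revenue in \<open>L\<close>, and the square remains in the gap.\<close>
  have square: "A i j * \<beta> j / 2 * ((x' $ i $ j)\<^sup>2 - (x $ i $ j)\<^sup>2)
      = A i j * \<beta> j / 2 * (D i j)\<^sup>2 + A i j * D i j * (\<beta> j * x $ i $ j)" for i j
    by (simp add: D_def field_simps power2_eq_square)
  have "P x' y' - P x y = (\<Sum>i\<in>UNIV. L i) - (\<Sum>i\<in>UNIV. \<Psi> i (x' $ i) - \<Psi> i (x $ i))
      + (\<Sum>j\<in>UNIV. \<Phi> j (z $ j) * f $ j) - (\<Sum>j\<in>UNIV. \<beta> j / 2 * (e $ j)\<^sup>2)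
      - (\<Sum>i\<in>UNIV. \<Sum>j\<in>UNIV. A i j * \<beta> j / 2 * (D i j)\<^sup>2)"
    using linear cournot_potential_increment[of x' y' x y, folded z_def e_def, unfolded square]
    by (simp add: sum.distrib sum_subtractf L_eq)
  then show ?thesis
    using producers operator by (simp add: e_def D_def)
qed

lemma nash_is_maximizer:
  assumes nash: "(x, y) \<in> nash_equilibria N \<Phi> \<Psi> \<omega>"
    and "x' \<in> production_profiles N" "y' \<in> operator_actions N"
  shows "P x' y' \<le> P x y"
proof -
  have "0 \<le> (\<Sum>j\<in>UNIV. \<beta> j / 2 * ((quantity x' y' - quantity x y) $ j)\<^sup>2)"
    using slope_pos by (intro sum_nonneg mult_nonneg_nonneg) (auto simp: less_imp_le)
  moreover have "0 \<le> (\<Sum>i\<in>UNIV. \<Sum>j\<in>UNIV. A i j * \<beta> j / 2 * (x' $ i $ j - x $ i $ j)\<^sup>2)"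
    using slope_pos adjacency_nonneg
    by (intro sum_nonneg mult_nonneg_nonneg divide_nonneg_nonneg) (auto simp: less_imp_le)
  ultimately show ?thesis
    using nash_potential_gap[OF assms] by linarith
qed

lemma nash_unique:
  assumes nash: "(x, y) \<in> nash_equilibria N \<Phi> \<Psi> \<omega>"
    and nash': "(x', y') \<in> nash_equilibria N \<Phi> \<Psi> \<omega>"
  shows "x = x'" "net_inflow N y = net_inflow N y'"
proof -
  let ?E = "\<lambda>j. \<beta> j / 2 * ((quantity x' y' - quantity x y) $ j)\<^sup>2"
  let ?D = "\<lambda>i j. A i j * \<beta> j / 2 * (x' $ i $ j - x $ i $ j)\<^sup>2"
  have x: "x \<in> production_profiles N" and y: "y \<in> operator_actions N"
    and x': "x' \<in> production_profiles N" and y': "y' \<in> operator_actions N"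
    using nash nash' by (auto simp: nash_equilibria_def)
  have E_nonneg: "0 \<le> ?E j" for j
    using slope_pos[of j] by simp
  have D_nonneg: "0 \<le> ?D i j" for i j
    using slope_pos[of j] adjacency_nonneg[of i j] by simp
  \<comment> \<open>The gap is taken at the first equilibrium, while the second one also maximizes
    the potential; hence nothing is left for the squares.\<close>
  have "(\<Sum>j\<in>UNIV. ?E j) + (\<Sum>i\<in>UNIV. \<Sum>j\<in>UNIV. ?D i j) \<le> 0"
    using nash_potential_gap[OF nash x' y'] nash_is_maximizer[OF nash' x y] by linarith
  moreover have "0 \<le> (\<Sum>j\<in>UNIV. ?E j)" "0 \<le> (\<Sum>i\<in>UNIV. \<Sum>j\<in>UNIV. ?D i j)"
    by (intro sum_nonneg E_nonneg D_nonneg)+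
  ultimately have "(\<Sum>j\<in>UNIV. ?E j) = 0" "(\<Sum>i\<in>UNIV. \<Sum>j\<in>UNIV. ?D i j) = 0"
    by linarith+
  then have E0: "?E j = 0" and D0: "?D i j = 0" for i j
    by (simp_all only: sum_nonneg_eq_0_iff finite E_nonneg D_nonneg sum_nonneg UNIV_I simp_thms)
  have "x $ i $ j = x' $ i $ j" for i j
  \<comment> \<open>On a market that a producer cannot serve, the square has weight zero, but
    feasibility forces both productions to vanish.\<close>
  proof (cases "A i j = 0")
    case True
    then show ?thesis
      using x x' by (auto simp: production_profiles_def producer_actions_def)
  next
    case False
    then show ?thesis using D0[of i j] slope_pos[of j] by simp
  qed
  then show "x = x'" by (simp add: vec_eq_iff)
  moreover have "quantity x' y' $ j = quantity x y $ j" for j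
    using E0[of j] slope_pos[of j] by simp
  then have "quantity x' y' = quantity x y"
    unfolding vec_eq_iff by blast
  \<comment> \<open>With equal productions the supplies agree, so equal quantities leave equal net
    inflows.\<close>
  ultimately show "net_inflow N y = net_inflow N y'"
    by simp
qed

lemma nash_eq_maximizers:
  "nash_equilibria N \<Phi> \<Psi> \<omega> =
    {p. is_arg_max (\<lambda>(x, y). P x y) (\<lambda>p. p \<in> production_profiles N \<times> operator_actions N) p}"
proof (intro set_eqI)
  fix p :: "(real ^ 'm ^ 'n) \<times> ('l \<Rightarrow> real)"
  obtain x y where p: "p = (x, y)" by fastforce
  have "p \<in> nash_equilibria N \<Phi> \<Psi> \<omega> \<longleftrightarrow> x \<in> production_profiles N \<and> y \<in> operator_actions N \<and>
      (\<forall>x'\<in>production_profiles N. \<forall>y'\<in>operator_actions N. P x' y' \<le> P x y)"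
    using nash_is_maximizer[of x y] maximizer_is_nash[of x y]
    by (auto simp: p nash_equilibria_def)
  then show "p \<in> nash_equilibria N \<Phi> \<Psi> \<omega> \<longleftrightarrow> p \<in> {p. is_arg_max (\<lambda>(x, y). P x y)
      (\<lambda>p. p \<in> production_profiles N \<times> operator_actions N) p}"
    by (auto simp: p is_arg_max_def not_less)
qed

end

theorem theorem2:
  fixes N :: "('n::finite, 'm::finite, 'l) network"
    and \<Psi> :: "'n \<Rightarrow> real ^ 'm \<Rightarrow> real"
    and \<Phi> :: "'m \<Rightarrow> real \<Rightarrow> real"
    and \<beta> :: "'m \<Rightarrow> real"
    and \<omega> :: "real ^ 'm ^ 'n \<Rightarrow> real ^ 'm \<Rightarrow> real"
    and P :: "real ^ 'm ^ 'n \<Rightarrow> ('l \<Rightarrow> real) \<Rightarrow> real"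
  assumes network: "market_network N"
    and cost: "\<And>i. production_cost (\<Psi> i)"
    and affine: "\<And>j. \<exists>a b. \<forall>s. \<Phi> j s = a + b * s"
    and slope: "\<And>j s. (\<Phi> j has_real_derivative - \<beta> j) (at s)"
    and slope_neg: "\<And>j. - \<beta> j < 0"
    and welfare: "\<omega> = walrasian_welfare \<Phi> \<Psi>"
    and potential: "P = cournot_potential N \<omega> \<beta>"
  shows "is_exact_potential N \<Phi> \<Psi> \<omega> P \<and>
    nash_equilibria N \<Phi> \<Psi> \<omega> =
      {p. is_arg_max (\<lambda>(x, y). P x y) (\<lambda>p. p \<in> production_profiles N \<times> operator_actions N) p} \<and>
    (\<forall>x y x' y'. (x, y) \<in> nash_equilibria N \<Phi> \<Psi> \<omega> \<longrightarrow> (x', y') \<in> nash_equilibria N \<Phi> \<Psi> \<omega> \<longrightarrow>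
      x = x' \<and> net_inflow N y = net_inflow N y')"
proof -
  have demand: "\<Phi> j s = \<Phi> j 0 - \<beta> j * s" for j s
  proof -
    obtain a b where ab: "\<And>s. \<Phi> j s = a + b * s" using affine by blast
    then have "\<Phi> j = (\<lambda>s. a + b * s)" by auto
    \<comment> \<open>Uniqueness of the derivative, here at 0, identifies the anonymous slope
      \<open>b\<close> with \<open>- \<beta> j\<close>.\<close>
    then have "(\<Phi> j has_real_derivative b) (at 0)" by (auto intro!: derivative_eq_intros)
    then have "b = - \<beta> j" using slope by (rule DERIV_unique)
    then show ?thesis by (simp add: ab)
  qed
  interpret affine_ncgso N \<Psi> \<Phi> \<beta>
  proof
    show "adjacency N $ i $ j \<in> {0, 1}" for i j
      using network by (simp add: market_network_def)
    show "convex_on {0..} (\<Psi> i)" for i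
      using cost by (simp add: production_cost_def)
    show "\<Phi> j s = \<Phi> j 0 - \<beta> j * s" for j s by (rule demand)
    show "0 < \<beta> j" for j using slope_neg[of j] by simp
  qed
  show ?thesis
    unfolding potential welfare
    using exact_potential nash_eq_maximizers nash_unique by blast
qed

end
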